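(* Let $H = C_n\Omega \in \mathbb{C}^{2n\times 2n}$ be a definite Bethe–Salpeter Hamiltonian matrix with blocks $A, B \in \mathbb{C}^{n\times n}$. Suppose that $u_1\in\mathbb{C}^n$ satisfies $\operatorname{Re}(u_1^{\mathsf H}Au_1+u_1^{\mathsf H}B\overline{u}_1)=1$. Let $1\le k<n$, and apply a $k$-step Lanczos procedure to $H^2$ in the $\Omega$-inner product with starting vector $q_1=\begin{bmatrix}u_1\\ \overline{u}_1\end{bmatrix}$ (as described in the context), assuming that the procedure does not break down. Let $q_j=\begin{bmatrix}u_j\\ \overline{u}_j\end{bmatrix}$, $1\le j\le k$, be the resulting Lanczos vectors, let $U_k=[u_1,\ldots,u_k]\in\mathbb{C}^{n\times k}$, and let $V_k\in\mathbb{C}^{n\times k}$ be defined by $$\begin{bmatrix}V_k\\ \overline{V}_k\end{bmatrix}=\Omega\begin{bmatrix}U_k\\ \overline{U}_k\end{bmatrix},$$ i.e. $V_k=AU_k+B\overline{U}_k$. Then $$\begin{bmatrix}V_k&U_k\\ \overline{V}_k&-\overline{U}_k\end{bmatrix}^{\mathsf H}\begin{bmatrix}U_k&V_k\\ \overline{U}_k&-\overline{V}_k\end{bmatrix}=2I_{2k}.$$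
   Context: Notation: $\overline{M}$ is the entrywise complex conjugate, $M^{\mathsf H}$ the conjugate transpose, $I_m$ the $m\times m$ identity matrix. A Bethe–Salpeter Hamiltonian matrix is a matrix $H=\begin{bmatrix}A&B\\-\overline{B}&-\overline{A}\end{bmatrix}\in\mathbb{C}^{2n\times2n}$ with $A^{\mathsf H}=A$ and $\overline{B}^{\mathsf H}=B$ (i.e. $A$ is Hermitian and $B$ is complex symmetric). One writes $H=C_n\Omega$ with $$C_n=\begin{bmatrix}I_n&0\\0&-I_n\end{bmatrix},\qquad \Omega=\begin{bmatrix}A&B\\ \overline{B}&\overline{A}\end{bmatrix}.$$ $H$ is called definite if the Hermitian matrix $\Omega$ is positive definite. The $\Omega$-inner product on $\mathbb{C}^{2n}$ is $\langle x,y\rangle_\Omega=y^{\mathsf H}\Omega x$. The matrix $H^2=(C_n\Omega C_n)\Omega$ is self-adjoint and positive definite with respect to this inner product. Lanczos procedure for $H^2$ in the $\Omega$-inner product, with all vectors normalized so that $\langle q,q\rangle_\Omega=2$: starting from $q_1$ with $\langle q_1,q_1\rangle_\Omega=2$, for $j=1,\ldots,k$ set $t_{ij}=\tfrac12\langle H^2q_j,q_i\rangle_\Omega$ for $1\le i\le j$, $w_j=H^2q_j-\sum_{i=1}^{j}t_{ij}q_i$, $\beta_j=\big(\tfrac12\langle w_j,w_j\rangle_\Omega\big)^{1/2}$, and $q_{j+1}=w_j/\beta_j$. The procedure breaks down if $w_j=0$ for some $j\le k$. The vectors $q_1,\ldots,q_{k+1}$ are the Lanczos vectors. With the starting vector $q_1=\begin{bmatrix}u_1\\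 \overline{u}_1\end{bmatrix}$, every Lanczos vector is of the form $q_j=\begin{bmatrix}u_j\\ \overline{u}_j\end{bmatrix}$ with $u_j\in\mathbb{C}^n$, and the procedure yields $$H^2\begin{bmatrix}U_k\\ \overline{U}_k\end{bmatrix}=\begin{bmatrix}U_k\\ \overline{U}_k\end{bmatrix}T_k+\beta_k\begin{bmatrix}u_{k+1}\\ \overline{u}_{k+1}\end{bmatrix}e_k^{\mathsf H}$$ with $T_k\in\mathbb{R}^{k\times k}$ real symmetric tridiagonal (diagonal entries $t_{jj}$, off-diagonal entries $\beta_1,\ldots,\beta_{k-1}$) and $e_k$ the $k$-th column of $I_k$. *)

theory Defs
  imports "Jordan_Normal_Form.Schur_Decomposition"
begin

abbreviation cnj_mat :: "complex mat \<Rightarrow> complex mat" where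
  "cnj_mat M \<equiv> map_mat cnj M"

definition C_mat :: "nat \<Rightarrow> complex mat" where
  "C_mat n = four_block_mat (1\<^sub>m n) (0\<^sub>m n n) (0\<^sub>m n n) (- 1\<^sub>m n)"

definition Omega_mat :: "complex mat \<Rightarrow> complex mat \<Rightarrow> complex mat" where
  "Omega_mat A B = four_block_mat A B (cnj_mat B) (cnj_mat A)"

definition bethe_salpeter :: "nat \<Rightarrow> complex mat \<Rightarrow> complex mat \<Rightarrow> complex mat \<Rightarrow> bool" where
  "bethe_salpeter n A B H \<longleftrightarrow>
     A \<in> carrier_mat n n \<and> B \<in> carrier_mat n n \<and>
     mat_adjoint A = A \<and> mat_adjoint (cnj_mat B) = B \<and>
     H = four_block_mat A B (- cnj_mat B) (- cnj_mat A)"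

lemma bethe_salpeter_eq_C_Omega:
  assumes "bethe_salpeter n A B H"
  shows "H = C_mat n * Omega_mat A B"
proof -
  have A: "A \<in> carrier_mat n n" and B: "B \<in> carrier_mat n n"
    and H: "H = four_block_mat A B (- cnj_mat B) (- cnj_mat A)"
    using assms by (auto simp: bethe_salpeter_def)
  have "C_mat n * Omega_mat A B = four_block_mat
      (1\<^sub>m n * A + 0\<^sub>m n n * cnj_mat B) (1\<^sub>m n * B + 0\<^sub>m n n * cnj_mat A)
      (0\<^sub>m n n * A + - 1\<^sub>m n * cnj_mat B) (0\<^sub>m n n * B + - 1\<^sub>m n * cnj_mat A)"
    unfolding C_mat_def Omega_mat_def
    by (rule mult_four_block_mat) (use A B in auto)
  also have "\<dots> = H"
    using A B unfolding H by simp
  finally show ?thesis by simp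
qed

text \<open>For Hermitian \<open>M\<close> the value \<open>x\<^sup>H M x = (M *\<^sub>v x) \<bullet>c x\<close> is real, so taking its
  real part loses nothing.\<close>

definition hermitian_pos_def :: "nat \<Rightarrow> complex mat \<Rightarrow> bool" where
  "hermitian_pos_def m M \<longleftrightarrow>
     M \<in> carrier_mat m m \<and> mat_adjoint M = M \<and>
     (\<forall>x\<in>carrier_vec m. x \<noteq> 0\<^sub>v m \<longrightarrow> 0 < Re ((M *\<^sub>v x) \<bullet>c x))"

definition definite_bethe_salpeter ::
    "nat \<Rightarrow> complex mat \<Rightarrow> complex mat \<Rightarrow> complex mat \<Rightarrow> bool" where
  "definite_bethe_salpeter n A B H \<longleftrightarrow>
     bethe_salpeter n A B H \<and> hermitian_pos_def (2 * n) (Omega_mat A B)"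

text \<open>\<open>y\<^sup>H G x\<close>: linear in the first argument, conjugate-linear in the second.\<close>

definition weighted_inner :: "complex mat \<Rightarrow> complex vec \<Rightarrow> complex vec \<Rightarrow> complex" where
  "weighted_inner G x y = (G *\<^sub>v x) \<bullet>c y"

text \<open>A \<open>k\<close>-step Lanczos run for the \<open>m \<times> m\<close> matrix \<open>M\<close> in the \<open>G\<close>-inner product, normalized
  to \<open>\<langle>q, q\<rangle> = 2\<close>. The data are indexed from 1, and only \<open>q 1, \<dots>, q (k + 1)\<close>,
  \<open>t i j\<close> (\<open>1 \<le> i \<le> j \<le> k\<close>), \<open>w 1, \<dots>, w k\<close> and \<open>\<beta> 1, \<dots>, \<beta> k\<close> are constrained.
  Absence of breakdown is the separate predicate \<open>lanczos_no_breakdown\<close>; without it the division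
  by \<open>\<beta> j\<close> may be a division by zero.\<close>

definition lanczos_run ::
    "nat \<Rightarrow> complex mat \<Rightarrow> complex mat \<Rightarrow> complex vec \<Rightarrow> nat \<Rightarrow> (nat \<Rightarrow> complex vec) \<Rightarrow>
     (nat \<Rightarrow> nat \<Rightarrow> complex) \<Rightarrow> (nat \<Rightarrow> complex vec) \<Rightarrow> (nat \<Rightarrow> real) \<Rightarrow> bool" where
  "lanczos_run m M G start k q t w \<beta> \<longleftrightarrow>
     q 1 = start \<and>
     (\<forall>j\<in>{1..k}.
        (\<forall>i\<in>{1..j}. t i j = weighted_inner G (M *\<^sub>v q j) (q i) / 2) \<and>
        w j = M *\<^sub>v q j - finsum_vec TYPE(complex) m (\<lambda>i. t i j \<cdot>\<^sub>v q i) {1..j} \<and>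
        \<beta> j = sqrt (Re (weighted_inner G (w j) (w j)) / 2) \<and>
        q (j + 1) = (1 / complex_of_real (\<beta> j)) \<cdot>\<^sub>v w j)"

definition lanczos_no_breakdown :: "nat \<Rightarrow> nat \<Rightarrow> (nat \<Rightarrow> complex vec) \<Rightarrow> bool" where
  "lanczos_no_breakdown m k w \<longleftrightarrow> (\<forall>j\<in>{1..k}. w j \<noteq> 0\<^sub>v m)"

end

theory Submission
  imports Defs
begin

text \<open>Put \<open>\<langle>x, y\<rangle>\<^sub>G = y\<^sup>H G x\<close>. On vectors of the form \<open>(u, cnj u)\<close> the \<open>\<Omega>\<close>-inner product is
  real, so all Lanczos coefficients are real and the Lanczos vectors are \<open>\<Omega>\<close>-orthogonal elements
  of the \<^emph>\<open>real\<close> Krylov space of \<open>H\<^sup>2\<close>. The off-diagonal blocks of the claim are the Gram matrices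
  of the Lanczos vectors for the Hermitian forms \<open>C\<close> and \<open>\<Omega> C \<Omega>\<close>. Since \<open>H\<^sup>2\<close> is self-adjoint for
  either form, each is symmetric on the real Krylov space; since it takes imaginary values on
  vectors \<open>(u, cnj u)\<close> and is Hermitian, it is also antisymmetric there, hence zero.\<close>

section \<open>Adjoints and weighted inner products\<close>

lemma dim_mat_adjoint [simp]:
  "dim_row (mat_adjoint M) = dim_col M" "dim_col (mat_adjoint M) = dim_row M"
  by (simp_all add: mat_adjoint_def)

lemma index_mat_adjoint [simp]:
  assumes "i < dim_col M" "j < dim_row M"
  shows "mat_adjoint M $$ (i, j) = conjugate (M $$ (j, i))"
  using assms by (simp add: mat_adjoint_def mat_of_rows_index)

lemma row_mat_adjoint:
  assumes "i < dim_col M"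
  shows "row (mat_adjoint M) i = conjugate (col M i)"
  using assms by (intro eq_vecI) auto

text \<open>Turns the final matrix identity into a statement about inner products of
  columns.\<close>

lemma mat_adjoint_mult_index:
  fixes X Y :: "complex mat"
  assumes "i < dim_col X" "j < dim_col Y" "dim_row X = dim_row Y"
  shows "(mat_adjoint X * Y) $$ (i, j) = col Y j \<bullet>c col X i"
  using assms
  by (simp add: row_mat_adjoint
      comm_scalar_prod[of "conjugate (col X i)" "dim_row Y"] carrier_vecI)

lemma cscalar_prod_swap:
  fixes x y :: "complex vec"
  assumes "x \<in> carrier_vec m" "y \<in> carrier_vec m"
  shows "y \<bullet>c x = cnj (x \<bullet>c y)"
  using assms by (auto simp: scalar_prod_def mult.commute intro!: sum.cong)

lemma mult_mat_vec_cscalar_prod: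
  fixes M :: "complex mat"
  assumes "M \<in> carrier_mat m m" "x \<in> carrier_vec m" "y \<in> carrier_vec m"
  shows "(M *\<^sub>v x) \<bullet>c y = x \<bullet>c (mat_adjoint M *\<^sub>v y)"
proof -
  have "(M *\<^sub>v x) \<bullet>c y = (\<Sum>i<m. \<Sum>j<m. M $$ (i, j) * x $ j * cnj (y $ i))"
    using assms by (auto simp: scalar_prod_def sum_distrib_right atLeast0LessThan intro!: sum.cong)
  also have "\<dots> = (\<Sum>j<m. \<Sum>i<m. M $$ (i, j) * x $ j * cnj (y $ i))"
    by (rule sum.swap)
  also have "\<dots> = x \<bullet>c (mat_adjoint M *\<^sub>v y)"
    using assms
    by (auto simp: scalar_prod_def sum_distrib_left atLeast0LessThan ac_simps intro!: sum.cong)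
  finally show ?thesis .
qed

lemma weighted_inner_swap:
  assumes "G \<in> carrier_mat m m" "mat_adjoint G = G" "x \<in> carrier_vec m" "y \<in> carrier_vec m"
  shows "weighted_inner G y x = cnj (weighted_inner G x y)"
  using assms mult_mat_vec_cscalar_prod[of G m y x] cscalar_prod_swap[of "G *\<^sub>v x" m y]
  by (simp add: weighted_inner_def)

lemma weighted_inner_add:
  assumes "G \<in> carrier_mat m m" "x \<in> carrier_vec m" "x' \<in> carrier_vec m" "y \<in> carrier_vec m"
  shows "weighted_inner G (x + x') y = weighted_inner G x y + weighted_inner G x' y"
    and "weighted_inner G (x - x') y = weighted_inner G x y - weighted_inner G x' y"
    and "weighted_inner G y (x + x') = weighted_inner G y x + weighted_inner G y x'"
  using assms
  by (simp_all add: weighted_inner_def mult_add_distrib_mat_vec mult_minus_distrib_mat_vec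
      add_scalar_prod_distrib[of _ m] minus_scalar_prod_distrib[of _ m] conjugate_add_vec[of _ m]
      scalar_prod_add_distrib[of _ m])

lemma weighted_inner_smult:
  assumes "G \<in> carrier_mat m m" "x \<in> carrier_vec m" "y \<in> carrier_vec m"
  shows "weighted_inner G (c \<cdot>\<^sub>v x) y = c * weighted_inner G x y"
    and "weighted_inner G x (c \<cdot>\<^sub>v y) = cnj c * weighted_inner G x y"
  using assms by (simp_all add: weighted_inner_def mult_mat_vec conjugate_smult_vec)

text \<open>Membership in the carrier is proved in the same induction, because additivity of the
  form in the insertion step needs it for the partial sum.\<close>

lemma weighted_inner_finsum_vec:
  assumes G: "G \<in> carrier_mat m m" and y: "y \<in> carrier_vec m"
    and "finite I" "\<And>i. i \<in> I \<Longrightarrow> f i \<in> carrier_vec m"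
  shows "finsum_vec TYPE(complex) m f I \<in> carrier_vec m \<and>
    weighted_inner G (finsum_vec TYPE(complex) m f I) y = (\<Sum>i\<in>I. weighted_inner G (f i) y)"
  using assms(3,4)
proof (induction I rule: finite_induct)
  case empty
  have "G *\<^sub>v 0\<^sub>v m = 0\<^sub>v m" using G by (intro eq_vecI) auto
  then show ?case using y by (simp add: finsum_vec_empty weighted_inner_def)
next
  case (insert a F)
  then have "finsum_vec TYPE(complex) m f (insert a F) = f a + finsum_vec TYPE(complex) m f F"
    by (intro finsum_vec_insert) auto
  with insert G y show ?case by (simp add: weighted_inner_add)
qed

section \<open>Orthogonality of the Lanczos vectors\<close>

text \<open>The run is a Gram-Schmidt process: \<open>w j\<close> is \<open>M *\<^sub>v q j\<close>
  minus its projections onto all of \<open>q 1\<close>, ..., \<open>q j\<close>, so orthogonality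
  follows by induction. Positive definiteness and the absence of breakdown make
  \<open>\<beta> j\<close> positive, so the normalization is a genuine division.\<close>

lemma lanczos_run_orthogonal:
  assumes G: "hermitian_pos_def m G" and M: "M \<in> carrier_mat m m"
    and start: "start \<in> carrier_vec m" "weighted_inner G start start = 2"
    and run: "lanczos_run m M G start k q t w \<beta>" and nb: "lanczos_no_breakdown m k w"
    and j: "j \<in> {1..k + 1}"
  shows "(\<forall>i\<in>{1..j}. q i \<in> carrier_vec m) \<and>
    (\<forall>i\<in>{1..j}. \<forall>l\<in>{1..j}. weighted_inner G (q i) (q l) = (if i = l then 2 else 0))"
  using j
proof (induction j rule: nat_induct)
  case 0
  then show ?case by simp
next
  case (Suc j)
  have Gc: "G \<in> carrier_mat m m" and Gh: "mat_adjoint G = G"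
    and Gp: "\<And>x. x \<in> carrier_vec m \<Longrightarrow> x \<noteq> 0\<^sub>v m \<Longrightarrow> 0 < Re (weighted_inner G x x)"
    using G by (auto simp: hermitian_pos_def_def weighted_inner_def)
  show ?case
  proof (cases "j = 0")
    case True
    then show ?thesis using run start by (auto simp: lanczos_run_def)
  next
    case False
    with Suc.prems have j: "j \<in> {1..k}" by auto
    with Suc.IH have car: "\<And>i. i \<in> {1..j} \<Longrightarrow> q i \<in> carrier_vec m"
      and orth: "\<And>i l. i \<in> {1..j} \<Longrightarrow> l \<in> {1..j} \<Longrightarrow>
        weighted_inner G (q i) (q l) = (if i = l then 2 else 0)" by auto
    have t: "\<And>i. i \<in> {1..j} \<Longrightarrow> t i j = weighted_inner G (M *\<^sub>v q j) (q i) / 2"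
      and w: "w j = M *\<^sub>v q j - finsum_vec TYPE(complex) m (\<lambda>i. t i j \<cdot>\<^sub>v q i) {1..j}"
      and b: "\<beta> j = sqrt (Re (weighted_inner G (w j) (w j)) / 2)"
      and q: "q (Suc j) = (1 / complex_of_real (\<beta> j)) \<cdot>\<^sub>v w j"
      using run j by (auto simp: lanczos_run_def)
    have Mq: "M *\<^sub>v q j \<in> carrier_vec m"
      using M car j by auto
    have fs: "finsum_vec TYPE(complex) m (\<lambda>i. t i j \<cdot>\<^sub>v q i) {1..j} \<in> carrier_vec m"
      using weighted_inner_finsum_vec[OF Gc Mq, of "{1..j}" "\<lambda>i. t i j \<cdot>\<^sub>v q i"] car by auto
    have wc: "w j \<in> carrier_vec m" unfolding w using Mq fs by simp
    have qc: "q (Suc j) \<in> carrier_vec m" unfolding q using wc by simp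
    have w0: "weighted_inner G (w j) (q l) = 0" if l: "l \<in> {1..j}" for l
    proof -
      have "weighted_inner G (finsum_vec TYPE(complex) m (\<lambda>i. t i j \<cdot>\<^sub>v q i) {1..j}) (q l)
          = (\<Sum>i\<in>{1..j}. weighted_inner G (t i j \<cdot>\<^sub>v q i) (q l))"
        using weighted_inner_finsum_vec[OF Gc car[OF l], of "{1..j}" "\<lambda>i. t i j \<cdot>\<^sub>v q i"] car
        by auto
      \<comment> \<open>Orthogonality leaves only \<open>i = l\<close>; the squared norm
        \<open>2\<close> then cancels the factor 1/2 in \<open>t l j\<close>.\<close>
      also have "\<dots> = (\<Sum>i\<in>{1..j}. if i = l then 2 * t i j else 0)"
        using orth l car by (intro sum.cong) (auto simp: weighted_inner_smult[OF Gc])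
      also have "\<dots> = 2 * t l j" using l by simp
      also have "\<dots> = weighted_inner G (M *\<^sub>v q j) (q l)" unfolding t[OF l] by simp
      finally show ?thesis
        unfolding w using weighted_inner_add(2)[OF Gc Mq fs car[OF l]] by simp
    qed
    have q0: "weighted_inner G (q (Suc j)) (q l) = 0" if "l \<in> {1..j}" for l
      unfolding q using w0[OF that] weighted_inner_smult(1)[OF Gc wc car[OF that]] by simp
    have q0': "weighted_inner G (q l) (q (Suc j)) = 0" if "l \<in> {1..j}" for l
      using weighted_inner_swap[OF Gc Gh qc car[OF that]] q0[OF that] by simp
    have pos: "0 < Re (weighted_inner G (w j) (w j))"
      using Gp[OF wc] nb j by (auto simp: lanczos_no_breakdown_def)
    \<comment> \<open>Hermitian symmetry makes the value real, so the real part under the square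
      root in \<open>\<beta> j\<close> loses nothing.\<close>
    have ww: "weighted_inner G (w j) (w j) = of_real (2 * (\<beta> j)\<^sup>2)"
      using weighted_inner_swap[OF Gc Gh wc wc] pos
      by (simp add: complex_eq_iff b)
    have "\<beta> j > 0" using pos by (simp add: b)
    then have q2: "weighted_inner G (q (Suc j)) (q (Suc j)) = 2"
      unfolding q using wc
      by (simp add: weighted_inner_smult[OF Gc] ww power2_eq_square)
    show ?thesis
      using car orth qc q0 q0' q2 by (auto simp: atLeastAtMostSuc_conv)
  qed
qed

section \<open>Real Krylov spaces\<close>

text \<open>Scalars are real because a form that is conjugate-linear in its second argument can be
  symmetric on a real span without being so on the complex one, and because \<open>sym_vecs\<close>
  is only a real subspace. Closure rules match the operations of a Lanczos step.\<close>

inductive_set real_krylov :: "complex mat \<Rightarrow> complex vec \<Rightarrow> complex vec set"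
  for M :: "complex mat" and s :: "complex vec" where
  start: "s \<in> real_krylov M s"
| mult: "x \<in> real_krylov M s \<Longrightarrow> M *\<^sub>v x \<in> real_krylov M s"
| add: "x \<in> real_krylov M s \<Longrightarrow> y \<in> real_krylov M s \<Longrightarrow> x + y \<in> real_krylov M s"
| smult: "x \<in> real_krylov M s \<Longrightarrow> complex_of_real c \<cdot>\<^sub>v x \<in> real_krylov M s"

lemma real_krylov_carrier:
  assumes "x \<in> real_krylov M s" "M \<in> carrier_mat m m" "s \<in> carrier_vec m"
  shows "x \<in> carrier_vec m"
  using assms by induction auto

lemma real_krylov_diff:
  assumes "x \<in> real_krylov M s" "y \<in> real_krylov M s" "M \<in> carrier_mat m m" "s \<in> carrier_vec m"
  shows "x - y \<in> real_krylov M s"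
proof -
  have "x - y = x + complex_of_real (- 1) \<cdot>\<^sub>v y"
    using real_krylov_carrier[OF assms(1,3,4)] real_krylov_carrier[OF assms(2,3,4)]
    by (intro eq_vecI) auto
  with assms(1,2) show ?thesis by (metis real_krylov.add real_krylov.smult)
qed

lemma real_krylov_finsum_vec:
  assumes M: "M \<in> carrier_mat m m" and s: "s \<in> carrier_vec m"
    and "finite I" "\<And>i. i \<in> I \<Longrightarrow> f i \<in> real_krylov M s"
  shows "finsum_vec TYPE(complex) m f I \<in> real_krylov M s"
  using assms(3,4)
proof (induction I rule: finite_induct)
  case empty
  \<comment> \<open>The zero vector enters the closure as \<open>0\<close> times the starting
    vector.\<close>
  have "complex_of_real 0 \<cdot>\<^sub>v s = 0\<^sub>v m" using s by auto
  then show ?case by (metis finsum_vec_empty real_krylov.start real_krylov.smult)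
next
  case (insert a F)
  then have "finsum_vec TYPE(complex) m f (insert a F) = f a + finsum_vec TYPE(complex) m f F"
    using real_krylov_carrier[OF _ M s] by (intro finsum_vec_insert) auto
  with insert show ?case by (simp add: real_krylov.add)
qed

text \<open>By self-adjointness the form on \<open>M\<close>-powers of \<open>s\<close> with
  exponents \<open>a\<close> and \<open>b\<close> depends only on \<open>a + b\<close>, hence is
  symmetric there. Symmetry passes to real linear combinations because conjugation fixes real
  scalars.\<close>

lemma real_krylov_weighted_inner_commute:
  assumes G: "G \<in> carrier_mat m m" and M: "M \<in> carrier_mat m m" and s: "s \<in> carrier_vec m"
    and sa: "\<And>x y. x \<in> carrier_vec m \<Longrightarrow> y \<in> carrier_vec m \<Longrightarrow>
      weighted_inner G (M *\<^sub>v x) y = weighted_inner G x (M *\<^sub>v y)"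
    and x: "x \<in> real_krylov M s" and y: "y \<in> real_krylov M s"
  shows "weighted_inner G x y = weighted_inner G y x"
proof -
  note car = real_krylov_carrier[OF _ M s]
  let ?p = "\<lambda>a. ((*\<^sub>v) M ^^ a) s"
  have pc: "?p a \<in> carrier_vec m" for a
    using M s by (induction a) auto
  have shift: "weighted_inner G (?p a) (?p b) = weighted_inner G s (?p (a + b))" for a b
  proof (induction a arbitrary: b)
    case (Suc a)
    show ?case using sa[OF pc[of a] pc[of b]] Suc.IH[of "Suc b"] by simp
  qed simp
  \<comment> \<open>First one argument stays a pure power. Applying \<open>M\<close> to the other is
    absorbed by raising the exponent, so \<open>a\<close> must be arbitrary in the
    induction.\<close>
  have power: "weighted_inner G (?p a) y = weighted_inner G y (?p a)"
    if "y \<in> real_krylov M s" for a y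
    using that
  proof (induction arbitrary: a)
    case start
    show ?case using shift[of a 0] by simp
  next
    case (mult x)
    then show ?case
      using sa[OF pc[of a] car[OF mult.hyps]] sa[OF car[OF mult.hyps] pc[of a]] mult.IH[of "Suc a"]
      by simp
  next
    case (add x y)
    then show ?case using pc car by (simp add: weighted_inner_add[OF G])
  next
    case (smult x c)
    then show ?case using pc car by (simp add: weighted_inner_smult[OF G])
  qed
  \<comment> \<open>Now the first argument varies too: \<open>M\<close> is moved onto
    \<open>y\<close>, which stays in the Krylov space, so \<open>y\<close> is kept
    arbitrary.\<close>
  show ?thesis
    using x y
  proof (induction arbitrary: y)
    case start
    then show ?case using power[of y 0] by simp
  next
    case (mult x)
    then show ?case
      using sa[OF car[OF mult.hyps] car[OF mult.prems]] sa[OF car[OF mult.prems] car[OF mult.hyps]]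
        mult.IH[OF real_krylov.mult[OF mult.prems]] by simp
  next
    case (add x x')
    then show ?case using car by (simp add: weighted_inner_add[OF G])
  next
    case (smult x c)
    then show ?case using car by (simp add: weighted_inner_smult[OF G])
  qed
qed

text \<open>Each \<open>t l i\<close> is half the form evaluated at two earlier members of the real
  Krylov space, hence real, and \<open>\<beta> i\<close> is real by type. So each step uses only
  real combinations and \<open>M\<close>.\<close>

lemma lanczos_run_real_krylov:
  assumes M: "M \<in> carrier_mat m m" and s: "s \<in> carrier_vec m"
    and run: "lanczos_run m M G s k q t w \<beta>"
    and real: "\<And>x y. x \<in> real_krylov M s \<Longrightarrow> y \<in> real_krylov M s \<Longrightarrow> weighted_inner G x y \<in> \<real>"
    and j: "j \<in> {1..k + 1}"
  shows "q j \<in> real_krylov M s"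
  using j
proof (induction j rule: less_induct)
  case (less j)
  show ?case
  proof (cases "j = 1")
    case True
    then show ?thesis using run by (auto simp: lanczos_run_def intro: real_krylov.start)
  next
    case False
    with less.prems obtain i where j: "j = Suc i" and i: "i \<in> {1..k}"
      by (cases j) auto
    have t: "\<And>l. l \<in> {1..i} \<Longrightarrow> t l i = weighted_inner G (M *\<^sub>v q i) (q l) / 2"
      and w: "w i = M *\<^sub>v q i - finsum_vec TYPE(complex) m (\<lambda>l. t l i \<cdot>\<^sub>v q l) {1..i}"
      and q: "q j = (1 / complex_of_real (\<beta> i)) \<cdot>\<^sub>v w i"
      using run i j by (auto simp: lanczos_run_def)
    have K: "q l \<in> real_krylov M s" if "l \<in> {1..i}" for l
      using less.IH[of l] that j i by auto
    have qi: "M *\<^sub>v q i \<in> real_krylov M s" using K i by (auto intro: real_krylov.mult)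
    have tq: "t l i \<cdot>\<^sub>v q l \<in> real_krylov M s" if "l \<in> {1..i}" for l
    proof -
      have "t l i \<in> \<real>" using real[OF qi K[OF that]] unfolding t[OF that]
        by (intro Reals_divide) auto
      then obtain r where "t l i = complex_of_real r" by (auto elim: Reals_cases)
      then show ?thesis using K[OF that] by (auto intro: real_krylov.smult)
    qed
    have "w i \<in> real_krylov M s"
      unfolding w using tq
      by (intro real_krylov_diff[OF qi _ M s] real_krylov_finsum_vec[OF M s]) auto
    \<comment> \<open>This also covers \<open>\<beta> i = 0\<close>, where the quotient is
      \<open>0\<close> by convention.\<close>
    then show ?thesis
      unfolding q using real_krylov.smult[of "w i" M s "1 / \<beta> i"] by simp
  qed
qed

section \<open>Vectors stable under swapping halves and conjugating\<close>

text \<open>The fixed points of the antilinear involution that swaps the two halves and conjugates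
  them: a real form of the complex space of dimension \<open>2 * n\<close>.\<close>

definition sym_vecs :: "nat \<Rightarrow> complex vec set" where
  "sym_vecs n = (\<lambda>u. u @\<^sub>v conjugate u) ` carrier_vec n"

lemma sym_vecsI: "u \<in> carrier_vec n \<Longrightarrow> u @\<^sub>v conjugate u \<in> sym_vecs n"
  by (simp add: sym_vecs_def)

lemma sym_vecsE:
  assumes "x \<in> sym_vecs n"
  obtains u where "u \<in> carrier_vec n" "x = u @\<^sub>v conjugate u"
  using assms by (auto simp: sym_vecs_def)

lemma sym_vecs_carrier: "x \<in> sym_vecs n \<Longrightarrow> x \<in> carrier_vec (2 * n)"
  by (auto simp: sym_vecs_def mult_2)

lemma sym_vecs_add:
  assumes "x \<in> sym_vecs n" "y \<in> sym_vecs n"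
  shows "x + y \<in> sym_vecs n"
proof -
  from assms obtain u v where u: "u \<in> carrier_vec n" "x = u @\<^sub>v conjugate u"
    and v: "v \<in> carrier_vec n" "y = v @\<^sub>v conjugate v"
    by (elim sym_vecsE)
  then have "x + y = (u + v) @\<^sub>v conjugate (u + v)"
    by (intro eq_vecI) auto
  with u v show ?thesis by (simp add: sym_vecsI)
qed

lemma sym_vecs_smult:
  assumes "x \<in> sym_vecs n"
  shows "complex_of_real c \<cdot>\<^sub>v x \<in> sym_vecs n"
proof -
  from assms obtain u where u: "u \<in> carrier_vec n" "x = u @\<^sub>v conjugate u"
    by (elim sym_vecsE)
  then have "complex_of_real c \<cdot>\<^sub>v x = (complex_of_real c \<cdot>\<^sub>v u) @\<^sub>v conjugate (complex_of_real c \<cdot>\<^sub>v u)"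
    by (intro eq_vecI) auto
  with u show ?thesis by (metis sym_vecsI smult_carrier_vec)
qed

lemma real_krylov_sym_vecs:
  assumes "x \<in> real_krylov M s" "s \<in> sym_vecs n"
    and "\<And>x. x \<in> sym_vecs n \<Longrightarrow> M *\<^sub>v x \<in> sym_vecs n"
  shows "x \<in> sym_vecs n"
  using assms by induction (auto intro: sym_vecs_add sym_vecs_smult)

text \<open>The lower halves contribute the conjugate of what the upper halves contribute. The sum
  is twice a real part; the sign change, which is the effect of \<open>C_mat n\<close>, leaves twice
  an imaginary part.\<close>

lemma cscalar_prod_append_conjugate:
  fixes u v :: "complex vec"
  assumes u: "u \<in> carrier_vec n" and v: "v \<in> carrier_vec n"
  shows "(u @\<^sub>v conjugate u) \<bullet>c (v @\<^sub>v conjugate v) = 2 * of_real (Re (u \<bullet>c v))"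
    and "(u @\<^sub>v - conjugate u) \<bullet>c (v @\<^sub>v conjugate v) = 2 * \<i> * of_real (Im (u \<bullet>c v))"
proof -
  have c: "conjugate (v @\<^sub>v conjugate v) = conjugate v @\<^sub>v v"
    by (intro eq_vecI) auto
  have "conjugate u \<bullet> v = cnj (u \<bullet>c v)"
    using u v conjugate_sprod_vec[of u n "conjugate v"] by simp
  then show "(u @\<^sub>v conjugate u) \<bullet>c (v @\<^sub>v conjugate v) = 2 * of_real (Re (u \<bullet>c v))"
    and "(u @\<^sub>v - conjugate u) \<bullet>c (v @\<^sub>v conjugate v) = 2 * \<i> * of_real (Im (u \<bullet>c v))"
    unfolding c using u v
    by (simp_all add: scalar_prod_append[of _ n _ n] complex_eq_iff)
qed

section \<open>The matrices \<open>C\<close> and \<open>Omega\<close> acting on conjugate-symmetric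
  vectors\<close>

lemma C_mat_carrier: "C_mat n \<in> carrier_mat (2 * n) (2 * n)"
  by (auto simp: C_mat_def mult_2)

lemma C_mat_mult_append:
  assumes "u \<in> carrier_vec n" "v \<in> carrier_vec n"
  shows "C_mat n *\<^sub>v (u @\<^sub>v v) = u @\<^sub>v - v"
proof -
  have "0\<^sub>m n n *\<^sub>v x = 0\<^sub>v n" if "x \<in> carrier_vec n" for x :: "complex vec"
    using that by (intro eq_vecI) auto
  then show ?thesis
    unfolding C_mat_def using assms
    by (subst four_block_mat_mult_vec[of _ n n _ n _ n]) (auto simp: carrier_vecD)
qed

lemma mat_adjoint_C_mat: "mat_adjoint (C_mat n) = C_mat n"
  by (rule eq_matI) (auto simp: C_mat_def)

lemma C_mat_involution:
  assumes "x \<in> carrier_vec (2 * n)"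
  shows "C_mat n *\<^sub>v (C_mat n *\<^sub>v x) = x"
proof -
  have "x \<in> carrier_vec (n + n)" using assms by (simp add: mult_2)
  then have x: "x = vec_first x n @\<^sub>v vec_last x n" by simp
  show ?thesis by (subst (1 2) x) (simp add: C_mat_mult_append)
qed

lemma cscalar_prod_C_mat:
  assumes "x \<in> carrier_vec (2 * n)" "y \<in> carrier_vec (2 * n)"
  shows "(C_mat n *\<^sub>v x) \<bullet>c y = x \<bullet>c (C_mat n *\<^sub>v y)"
  using mult_mat_vec_cscalar_prod[OF C_mat_carrier assms] by (simp add: mat_adjoint_C_mat)

text \<open>The value is purely imaginary; this form of saying so combines directly with Hermitian
  symmetry.\<close>

lemma weighted_inner_C_mat_sym_vecs:
  assumes "x \<in> sym_vecs n" "y \<in> sym_vecs n"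
  shows "weighted_inner (C_mat n) x y = - cnj (weighted_inner (C_mat n) x y)"
  using assms
  by (elim sym_vecsE)
    (simp add: weighted_inner_def C_mat_mult_append cscalar_prod_append_conjugate)

lemma Omega_mat_mult_append:
  assumes "A \<in> carrier_mat n n" "B \<in> carrier_mat n n" "u \<in> carrier_vec n" "v \<in> carrier_vec n"
  shows "Omega_mat A B *\<^sub>v (u @\<^sub>v v) = (A *\<^sub>v u + B *\<^sub>v v) @\<^sub>v (cnj_mat B *\<^sub>v u + cnj_mat A *\<^sub>v v)"
  unfolding Omega_mat_def using assms by (subst four_block_mat_mult_vec[of _ n n _ n _ n]) auto

lemma cnj_mat_mult_vec:
  assumes "M \<in> carrier_mat n n" "u \<in> carrier_vec n"
  shows "cnj_mat M *\<^sub>v u = conjugate (M *\<^sub>v conjugate u)"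
  using assms by (intro eq_vecI) (auto simp: scalar_prod_def)

lemma Omega_mat_mult_conjugate:
  assumes "A \<in> carrier_mat n n" "B \<in> carrier_mat n n" "u \<in> carrier_vec n"
  defines "v \<equiv> A *\<^sub>v u + B *\<^sub>v conjugate u"
  shows "Omega_mat A B *\<^sub>v (u @\<^sub>v conjugate u) = v @\<^sub>v conjugate v"
  using assms
  by (simp add: v_def Omega_mat_mult_append cnj_mat_mult_vec conjugate_add_vec[of _ n]
      comm_add_vec[of _ n])

lemma Omega_mat_sym_vecs:
  assumes "A \<in> carrier_mat n n" "B \<in> carrier_mat n n" "x \<in> sym_vecs n"
  shows "Omega_mat A B *\<^sub>v x \<in> sym_vecs n"
  using assms(3)
  by (elim sym_vecsE) (use assms(1,2) in \<open>simp add: Omega_mat_mult_conjugate sym_vecsI\<close>)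

text \<open>The inner \<open>C\<close> negates the lower half, \<open>Omega\<close> sends a
  conjugate-antisymmetric vector to one of the same kind, and the outer \<open>C\<close> restores
  the sign. Composed with \<open>Omega\<close> this gives invariance under \<open>H\<^sup>2\<close>,
  which factors as \<open>C Omega C\<close> times \<open>Omega\<close>.\<close>

lemma C_Omega_C_sym_vecs:
  assumes A: "A \<in> carrier_mat n n" and B: "B \<in> carrier_mat n n" and x: "x \<in> sym_vecs n"
  shows "C_mat n *\<^sub>v (Omega_mat A B *\<^sub>v (C_mat n *\<^sub>v x)) \<in> sym_vecs n"
proof -
  from x obtain u where u: "u \<in> carrier_vec n" "x = u @\<^sub>v conjugate u" by (elim sym_vecsE)
  define v where "v = A *\<^sub>v u + B *\<^sub>v (- conjugate u)"
  have "B *\<^sub>v (- conjugate u) = - (B *\<^sub>v conjugate u)"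
    using B u by (intro eq_vecI) auto
  moreover have "cnj_mat A *\<^sub>v (- conjugate u) = - (cnj_mat A *\<^sub>v conjugate u)"
    using A u by (intro eq_vecI) auto
  ultimately have "- (cnj_mat B *\<^sub>v u + cnj_mat A *\<^sub>v (- conjugate u)) = conjugate v"
    using A B u(1) unfolding v_def
    by (simp add: cnj_mat_mult_vec) (intro eq_vecI, auto)
  moreover have "v \<in> carrier_vec n" using A B u by (simp add: v_def)
  ultimately show ?thesis
    using A B u(1) unfolding u(2)
    by (simp add: C_mat_mult_append Omega_mat_mult_append sym_vecsI flip: v_def)
qed

section \<open>Vanishing of the off-diagonal Gram matrices\<close>

theorem theorem3:
  fixes n k :: nat
    and A B H U V :: "complex mat"
    and u\<^sub>1 :: "complex vec"
    and q w :: "nat \<Rightarrow> complex vec"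
    and t :: "nat \<Rightarrow> nat \<Rightarrow> complex"
    and \<beta> :: "nat \<Rightarrow> real"
  assumes "definite_bethe_salpeter n A B H"
    and "u\<^sub>1 \<in> carrier_vec n"
    and "Re ((A *\<^sub>v u\<^sub>1) \<bullet>c u\<^sub>1 + (B *\<^sub>v conjugate u\<^sub>1) \<bullet>c u\<^sub>1) = 1"
    and "1 \<le> k" and "k < n"
    and "lanczos_run (2 * n) (H * H) (Omega_mat A B) (u\<^sub>1 @\<^sub>v conjugate u\<^sub>1) k q t w \<beta>"
    and "lanczos_no_breakdown (2 * n) k w"
    and "U = mat_of_cols n (map (\<lambda>j. vec_first (q j) n) [1..<k + 1])"
    and "V \<in> carrier_mat n k"
    and "V @\<^sub>r cnj_mat V = Omega_mat A B * (U @\<^sub>r cnj_mat U)"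
  shows "mat_adjoint (four_block_mat V U (cnj_mat V) (- cnj_mat U))
           * four_block_mat U V (cnj_mat U) (- cnj_mat V)
         = 2 \<cdot>\<^sub>m 1\<^sub>m (2 * k)"
proof -
  let ?O = "Omega_mat A B" and ?C = "C_mat n" and ?M = "H * H"
  let ?s = "u\<^sub>1 @\<^sub>v conjugate u\<^sub>1"
  let ?K = "real_krylov ?M ?s"
  have bs: "bethe_salpeter n A B H" and pd: "hermitian_pos_def (2 * n) ?O"
    using assms(1) by (auto simp: definite_bethe_salpeter_def)
  have A: "A \<in> carrier_mat n n" and B: "B \<in> carrier_mat n n"
    using bs by (auto simp: bethe_salpeter_def)
  have O: "?O \<in> carrier_mat (2 * n) (2 * n)" and Oh: "mat_adjoint ?O = ?O"
    using pd by (auto simp: hermitian_pos_def_def)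
  note C = C_mat_carrier[of n]
  have H: "H = ?C * ?O" by (rule bethe_salpeter_eq_C_Omega[OF bs])
  have M: "?M \<in> carrier_mat (2 * n) (2 * n)" unfolding H by (intro mult_carrier_mat) (use O C in auto)
  have Mx: "?M *\<^sub>v x = ?C *\<^sub>v (?O *\<^sub>v (?C *\<^sub>v (?O *\<^sub>v x)))" if "x \<in> carrier_vec (2 * n)" for x
    using that O C unfolding H by (simp add: assoc_mult_mat_vec[of _ "2 * n" "2 * n" _ "2 * n"])
  have s: "?s \<in> sym_vecs n" using assms(2) by (rule sym_vecsI)
  note sc = sym_vecs_carrier[OF s]
  have Msym: "?M *\<^sub>v x \<in> sym_vecs n" if "x \<in> sym_vecs n" for x
    using C_Omega_C_sym_vecs[OF A B Omega_mat_sym_vecs[OF A B that]] Mx[OF sym_vecs_carrier[OF that]]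
    by simp
  have Ksym: "x \<in> sym_vecs n" if "x \<in> ?K" for x
    using real_krylov_sym_vecs[OF that s Msym] .

  have O_swap: "(?O *\<^sub>v x) \<bullet>c y = x \<bullet>c (?O *\<^sub>v y)"
    if "x \<in> carrier_vec (2 * n)" "y \<in> carrier_vec (2 * n)" for x y
    using mult_mat_vec_cscalar_prod[OF O that] by (simp add: Oh)
  have O_real: "weighted_inner ?O x y \<in> \<real>" if "x \<in> ?K" "y \<in> ?K" for x y
    using Omega_mat_sym_vecs[OF A B Ksym[OF that(1)]] Ksym[OF that(2)]
    by (elim sym_vecsE) (simp add: weighted_inner_def cscalar_prod_append_conjugate)
  have "A *\<^sub>v u\<^sub>1 + B *\<^sub>v conjugate u\<^sub>1 \<in> carrier_vec n"
    using A B assms(2) by (intro add_carrier_vec) auto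
  \<comment> \<open>The form at the start vector is twice the real part that the normalization
    hypothesis sets to 1.\<close>
  then have "weighted_inner ?O ?s ?s = 2"
    using assms(2,3) A B
    by (simp add: weighted_inner_def Omega_mat_mult_conjugate
        cscalar_prod_append_conjugate(1)[of _ n] add_scalar_prod_distrib[of _ n])
  note orth = lanczos_run_orthogonal[OF pd M sc this assms(6,7), of "k + 1"]
  have qK: "q j \<in> ?K" if "j \<in> {1..k + 1}" for j
    by (rule lanczos_run_real_krylov[OF M sc assms(6) O_real that])

  \<comment> \<open>Symmetry on the Krylov space together with Hermitian symmetry makes the value
    real, while the last premise makes it purely imaginary.\<close>
  have form_zero: "weighted_inner G x y = 0"
    if G: "G \<in> carrier_mat (2 * n) (2 * n)" and K: "x \<in> ?K" "y \<in> ?K"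
      and "\<And>x y. x \<in> carrier_vec (2 * n) \<Longrightarrow> y \<in> carrier_vec (2 * n) \<Longrightarrow>
        weighted_inner G (?M *\<^sub>v x) y = weighted_inner G x (?M *\<^sub>v y)"
      and "weighted_inner G y x = cnj (weighted_inner G x y)"
      and "weighted_inner G x y = - cnj (weighted_inner G x y)" for G x y
    using real_krylov_weighted_inner_commute[OF G M sc that(4) K] that(5,6) by simp
  have zero1: "weighted_inner ?C x y = 0" if K: "x \<in> ?K" "y \<in> ?K" for x y
  proof (rule form_zero[OF C K])
    \<comment> \<open>\<open>C\<close> cancels the leading \<open>C\<close> of
      \<open>H\<^sup>2\<close>, and what remains, \<open>Omega C Omega\<close>, is
      Hermitian.\<close>
    show "weighted_inner ?C (?M *\<^sub>v x) y = weighted_inner ?C x (?M *\<^sub>v y)"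
      if "x \<in> carrier_vec (2 * n)" "y \<in> carrier_vec (2 * n)" for x y
      using that O C
      by (simp add: weighted_inner_def Mx C_mat_involution cscalar_prod_C_mat O_swap)
    show "weighted_inner ?C y x = cnj (weighted_inner ?C x y)"
      using weighted_inner_swap[OF C mat_adjoint_C_mat] K Ksym sym_vecs_carrier by blast
    show "weighted_inner ?C x y = - cnj (weighted_inner ?C x y)"
      using weighted_inner_C_mat_sym_vecs K Ksym by blast
  qed
  \<comment> \<open>One matrix representing the \<open>C\<close>-form on images under
    \<open>Omega\<close>, so that \<open>form_zero\<close> applies to it.\<close>
  let ?G = "?O * (?C * ?O)"
  have G: "weighted_inner ?G x y = weighted_inner ?C (?O *\<^sub>v x) (?O *\<^sub>v y)"
    if "x \<in> carrier_vec (2 * n)" "y \<in> carrier_vec (2 * n)" for x y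
    using that O C
    by (simp add: weighted_inner_def O_swap assoc_mult_mat_vec[of _ "2 * n" "2 * n" _ "2 * n"])
  have zero2: "weighted_inner ?C (?O *\<^sub>v x) (?O *\<^sub>v y) = 0" if K: "x \<in> ?K" "y \<in> ?K" for x y
  proof -
    note xy = K[THEN Ksym]
    note xyc = xy[THEN sym_vecs_carrier]
    have "weighted_inner ?G x y = 0"
    proof (rule form_zero[OF _ K])
      show "?G \<in> carrier_mat (2 * n) (2 * n)" using O C by simp
      \<comment> \<open>The product of \<open>?G\<close> and \<open>H\<^sup>2\<close> is a
        palindrome in the Hermitian matrices \<open>Omega\<close> and \<open>C\<close>, hence
        Hermitian.\<close>
      show "weighted_inner ?G (?M *\<^sub>v x) y = weighted_inner ?G x (?M *\<^sub>v y)"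
        if "x \<in> carrier_vec (2 * n)" "y \<in> carrier_vec (2 * n)" for x y
      proof -
        have "?M *\<^sub>v x \<in> carrier_vec (2 * n)" "?M *\<^sub>v y \<in> carrier_vec (2 * n)" using that M by auto
        then have "weighted_inner ?G (?M *\<^sub>v x) y = weighted_inner ?C (?O *\<^sub>v (?M *\<^sub>v x)) (?O *\<^sub>v y)"
          "weighted_inner ?G x (?M *\<^sub>v y) = weighted_inner ?C (?O *\<^sub>v x) (?O *\<^sub>v (?M *\<^sub>v y))"
          using that G by auto
        then show ?thesis
          using that O C by (simp add: weighted_inner_def Mx cscalar_prod_C_mat O_swap)
      qed
      show "weighted_inner ?G y x = cnj (weighted_inner ?G x y)"
        using weighted_inner_swap[OF C mat_adjoint_C_mat, of "?O *\<^sub>v x" "?O *\<^sub>v y"] xyc O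
        by (simp add: G)
      \<comment> \<open>\<open>Omega\<close> preserves conjugate-symmetric vectors, so the values of
        the \<open>C\<close>-form remain imaginary.\<close>
      show "weighted_inner ?G x y = - cnj (weighted_inner ?G x y)"
        using weighted_inner_C_mat_sym_vecs Omega_mat_sym_vecs[OF A B] xy xyc by (simp add: G)
    qed
    with xyc show ?thesis by (simp add: G)
  qed

  \<comment> \<open>Columns of the two block matrices and their inner products\<close>
  have U: "U \<in> carrier_mat n k" using assms(8) by auto
  note V = assms(9)
  \<comment> \<open>Matrix columns count from 0, Lanczos vectors from 1.\<close>
  define p where "p j = q (Suc j)" for j
  have pK: "p j \<in> ?K" if "j < k" for j using qK[of "Suc j"] that by (simp add: p_def)
  have pc: "p j \<in> carrier_vec (2 * n)" if "j < k" for j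
    using pK[OF that] Ksym sym_vecs_carrier by blast
  have Opc: "?O *\<^sub>v p j \<in> carrier_vec (2 * n)" if "j < k" for j using pc[OF that] O by auto
  have pp: "(?O *\<^sub>v p i) \<bullet>c p j = (if i = j then 2 else 0)" if "i < k" "j < k" for i j
    using orth that by (auto simp: p_def weighted_inner_def)
  \<comment> \<open>A conjugate-symmetric vector is determined by its upper half, so the truncation
    in \<open>U\<close> loses nothing.\<close>
  have colU: "col U j @\<^sub>v conjugate (col U j) = p j" if "j < k" for j
  proof -
    from pK[OF that] obtain u where u: "u \<in> carrier_vec n" "p j = u @\<^sub>v conjugate u"
      by (blast elim: sym_vecsE dest: Ksym)
    have "col U j = vec_first (p j) n"
      unfolding assms(8) using that by (subst col_mat_of_cols) (auto simp: p_def simp del: upt_Suc)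
    also have "\<dots> = u" unfolding u(2) using u(1) by (intro eq_vecI) (auto simp: vec_first_def)
    finally show ?thesis using u by simp
  qed
  have col_append: "col (X @\<^sub>r cnj_mat X) j = col X j @\<^sub>v conjugate (col X j)"
    if "X \<in> carrier_mat n k" "j < k" for X j
    using that by (intro eq_vecI) (auto simp: append_rows_def)
  have "U @\<^sub>r cnj_mat U \<in> carrier_mat (2 * n) k"
    using carrier_append_rows[of U n k "cnj_mat U" n] U by (simp add: mult_2)
  then have "col (V @\<^sub>r cnj_mat V) j = ?O *\<^sub>v col (U @\<^sub>r cnj_mat U) j" if "j < k" for j
    unfolding assms(10) using col_mult2[OF O _ that] by blast
  then have colV: "col V j @\<^sub>v conjugate (col V j) = ?O *\<^sub>v p j" if "j < k" for j
    using that col_append[OF V that] col_append[OF U that] colU[OF that] by metis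
  \<comment> \<open>The minus sign in the lower right block is the action of \<open>C\<close> on a
    conjugate-symmetric column. Both factors of the claim have this shape, with \<open>U\<close> and
    \<open>V\<close> exchanged.\<close>
  have col_block: "col (four_block_mat X Y (cnj_mat X) (- cnj_mat Y)) j =
      (if j < k then col X j @\<^sub>v conjugate (col X j)
       else ?C *\<^sub>v (col Y (j - k) @\<^sub>v conjugate (col Y (j - k))))"
    if "X \<in> carrier_mat n k" "Y \<in> carrier_mat n k" "j < k + k" for X Y j
  proof -
    have "col Y (j - k) \<in> carrier_vec n" using that(2) by auto
    then show ?thesis
      using that by (intro eq_vecI) (auto simp: C_mat_mult_append)
  qed
  let ?X = "four_block_mat V U (cnj_mat V) (- cnj_mat U)"
  let ?Y = "four_block_mat U V (cnj_mat U) (- cnj_mat V)"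
  show ?thesis
  proof (rule eq_matI)
    fix i j
    assume "i < dim_row (2 \<cdot>\<^sub>m 1\<^sub>m (2 * k) :: complex mat)" "j < dim_col (2 \<cdot>\<^sub>m 1\<^sub>m (2 * k) :: complex mat)"
    then have i: "i < k + k" and j: "j < k + k" by auto
    have "(mat_adjoint ?X * ?Y) $$ (i, j) = col ?Y j \<bullet>c col ?X i"
      using U V i j by (intro mat_adjoint_mult_index) auto
    also have "\<dots> = (if j < k then p j else ?C *\<^sub>v (?O *\<^sub>v p (j - k)))
        \<bullet>c (if i < k then ?O *\<^sub>v p i else ?C *\<^sub>v p (i - k))"
      using i j by (simp add: col_block[OF U V j] col_block[OF V U i] colU colV)
    also have "\<dots> = (if i = j then 2 else 0)"
    proof -
      \<comment> \<open>The diagonal blocks reduce to \<open>Omega\<close>-orthogonality, the two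
        factors \<open>C\<close> cancelling in the lower one. The upper right block is
        \<open>zero2\<close>, the lower left one \<open>zero1\<close>.\<close>
      consider "i < k" "j < k" | "i < k" "\<not> j < k" | "\<not> i < k" "j < k" | "\<not> i < k" "\<not> j < k"
        by blast
      then show ?thesis
      proof cases
        case 1
        then show ?thesis using O_swap[OF pc pc, of j i] pp[of j i] by auto
      next
        case 2
        then have "j - k < k" using j by simp
        then show ?thesis using 2 zero2[OF pK pK, of "j - k" i] by (auto simp: weighted_inner_def)
      next
        case 3
        then have "i - k < k" using i by simp
        then show ?thesis
          using 3 zero1[OF pK pK, of j "i - k"] cscalar_prod_C_mat[OF pc pc, of j "i - k"]
          by (auto simp: weighted_inner_def)
      next
        case 4
        then have ij: "i - k < k" "j - k < k" using i j by auto
        have "(?C *\<^sub>v (?O *\<^sub>v p (j - k))) \<bullet>c (?C *\<^sub>v p (i - k)) = (?O *\<^sub>v p (j - k)) \<bullet>c p (i - k)"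
          using cscalar_prod_C_mat[OF Opc[OF ij(2)], of "?C *\<^sub>v p (i - k)"] C pc[OF ij(1)]
          by (simp add: C_mat_involution)
        then show ?thesis using 4 pp[OF ij(2,1)] by auto
      qed
    qed
    finally show "(mat_adjoint ?X * ?Y) $$ (i, j) = (2 \<cdot>\<^sub>m 1\<^sub>m (2 * k)) $$ (i, j)"
      using i j by simp
  qed (use U V in auto)
qed

end
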